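(* Let $n$ be a positive integer, let $\mathfrak A=(A_1,\dots,A_k)$ be an ordered partition of $[n]$ into $k$ nonempty blocks, and let $1\le r\le n$. Then: (i) the number of parking functions of length $n$ of type $\mathfrak A$ and the number of rook words of length $n$ of type $\mathfrak A$ are both equal to $\binom{n}{k-1}$; (ii) the number of parking functions $\mathbf a$ of length $n$ of type $\mathfrak A$ with $\operatorname{run}(\mathbf a)=r$ and the number of rook words $\mathbf a$ of length $n$ of type $\mathfrak A$ with $\operatorname{run}(\mathbf a)=r$ are both equal to $r\binom{n-r-1}{k-r}$.
   Context: Let $[n]=\{1,\dots,n\}$ and $\mathbf a=(a_1,\dots,a_n)\in[n]^n$. $\mathbf a$ is a parking function if $|\{j:a_j\le i\}|\ge i$ for every $i\in[n]$. If $1\in\{a_1,\dots,a_n\}$, $\operatorname{run}(\mathbf a)=\max\{i\in[n]:[i]\subseteq\{a_1,\dots,a_n\}\}$; otherwise $\operatorname{run}(\mathbf a)=0$. $\mathbf a$ is a rook word if $a_1\le\operatorname{run}(\mathbf a)$. The coimage $\operatorname{coim}(\mathbf a)$ is the ordered partition of $[n]$ into the nonempty fibers $\mathbf a^{-1}(\{x\})$, $x\in\{a_1,\dots,a_n\}$, listed in increasing order of $x$. $\mathbf a$ is of type $\mathfrak A=(A_1,\dots,A_k)$ if $\operatorname{coim}(\mathbf a)$ is a cyclic permutation of $\mathfrak A$, i.e. equals $(A_{j+1},\dots,A_k,A_1,\dots,A_j)$ for some $0\le j<k$. *)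

theory Defs
  imports Main "HOL-Library.FuncSet"
begin

definition words :: "nat \<Rightarrow> (nat \<Rightarrow> nat) set" where
  "words n = {1..n} \<rightarrow>\<^sub>E {1..n}"

definition parking_function :: "nat \<Rightarrow> (nat \<Rightarrow> nat) \<Rightarrow> bool" where
  "parking_function n a \<longleftrightarrow> a \<in> words n \<and>
     (\<forall>i\<in>{1..n}. card {j\<in>{1..n}. a j \<le> i} \<ge> i)"

definition run :: "nat \<Rightarrow> (nat \<Rightarrow> nat) \<Rightarrow> nat" where
  "run n a = (if 1 \<in> a ` {1..n} then Max {i\<in>{1..n}. {1..i} \<subseteq> a ` {1..n}} else 0)"

definition rook_word :: "nat \<Rightarrow> (nat \<Rightarrow> nat) \<Rightarrow> bool" where
  "rook_word n a \<longleftrightarrow> a \<in> words n \<and> a 1 \<le> run n a"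

definition coim :: "nat \<Rightarrow> (nat \<Rightarrow> nat) \<Rightarrow> nat set list" where
  "coim n a = map (\<lambda>x. {j\<in>{1..n}. a j = x}) (sorted_list_of_set (a ` {1..n}))"

definition ordered_partition :: "nat \<Rightarrow> nat set list \<Rightarrow> bool" where
  "ordered_partition n As \<longleftrightarrow>
     (\<forall>i<length As. As ! i \<noteq> {}) \<and>
     (\<forall>i<length As. \<forall>j<length As. i \<noteq> j \<longrightarrow> As ! i \<inter> As ! j = {}) \<and>
     \<Union>(set As) = {1..n}"

definition of_type :: "nat \<Rightarrow> (nat \<Rightarrow> nat) \<Rightarrow> nat set list \<Rightarrow> bool" where
  "of_type n a As \<longleftrightarrow> (\<exists>j<length As. coim n a = rotate j As)"

end

theory Submission
  imports Defs
begin

text \<open>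
  A word of type \<open>\<AA>\<close> amounts to a rotation \<open>(B\<^sub>1, \<dots>, B\<^sub>k)\<close> of \<open>\<AA>\<close> together with its set of values
  \<open>s\<^sub>1 < \<dots> < s\<^sub>k\<close>; it is a parking function iff \<open>s\<^sub>m\<^sub>+\<^sub>1 \<le> 1 + |B\<^sub>1| + \<dots> + |B\<^sub>m|\<close> for all \<open>m < k\<close>, and its run is at
  least \<open>r\<close> iff \<open>{1, \<dots>, r}\<close> is contained in the set of values.
  For rook words every set of values with run \<open>r\<close> admits exactly \<open>r\<close> of the \<open>k\<close> rotations, namely those that put the
  block containing \<open>1\<close> among the first \<open>r\<close>.

  For parking functions such a statement fails for an individual set of values. Instead, the sum over all
  rotations depends only on \<open>y\<^sub>1 + \<dots> + y\<^sub>k\<close>, where \<open>y\<^sub>i = |B\<^sub>i| - 1\<close>: moving a unit from the last to the first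
  entry of \<open>(y\<^sub>1, \<dots>, y\<^sub>k)\<close> changes the sum by a commutator of two counting functions on lists, under the
  convolution that splits a list in two. The counts with \<open>r\<close> forced initial values are \<open>q\<^sup>r * c\<close>, where \<open>c = 1 + q * c\<close>
  counts all admissible sequences and \<open>q\<close> the indecomposable ones, so the commutator vanishes. It remains to evaluate the sum
  at \<open>(0, \<dots>, 0, n - k)\<close>. The total for rook words follows by summing over \<open>r\<close>.
\<close>

subsection \<open>Counting dominated sequences\<close>

text \<open>The number of \<open>g\<close> of the same length and sum as the list, all of whose partial sums are at most those of the
  list. In the recursion \<open>e\<close> is the surplus after the first entry, which is carried over to the second.\<close>
fun dom_count :: "nat list \<Rightarrow> nat" where
  "dom_count [] = 1"
| "dom_count [a] = 1"
| "dom_count (a # b # ys) = (\<Sum>e\<le>a. dom_count ((b + e) # ys))"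

text \<open>The same with strict domination before the end.\<close>
fun prime_count :: "nat list \<Rightarrow> nat" where
  "prime_count [] = 0"
| "prime_count [a] = 1"
| "prime_count (a # b # ys) = (\<Sum>e\<in>{1..a}. prime_count ((b + e) # ys))"

text \<open>The same as \<open>dom_count\<close>, with the first \<open>r - 1\<close> entries of \<open>g\<close> equal to \<open>0\<close>; it is \<open>0\<close> if \<open>r = 0\<close> or if
  \<open>r\<close> exceeds the length.\<close>
fun init_count :: "nat \<Rightarrow> nat list \<Rightarrow> nat" where
  "init_count (Suc 0) (a # ys) = dom_count (a # ys)"
| "init_count (Suc (Suc r)) (a # b # ys) = init_count (Suc r) ((a + b) # ys)"
| "init_count _ _ = 0"

section \<open>The convolution product on functions of lists\<close>

primrec split_conv :: "('a list \<Rightarrow> nat) \<Rightarrow> ('a list \<Rightarrow> nat) \<Rightarrow> 'a list \<Rightarrow> nat" where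
  "split_conv f g [] = f [] * g []"
| "split_conv f g (x # xs) = f [] * g (x # xs) + split_conv (\<lambda>l. f (x # l)) g xs"

lemma split_conv_eq_sum:
  "split_conv f g xs = (\<Sum>t\<le>length xs. f (take t xs) * g (drop t xs))"
  by (induction xs arbitrary: f) (simp_all add: sum.atMost_Suc_shift del: sum.atMost_Suc)

lemma split_conv_add_left:
  "split_conv (\<lambda>l. f l + g l) h xs = split_conv f h xs + split_conv g h xs"
  by (simp add: split_conv_eq_sum distrib_right sum.distrib)

lemma split_conv_mult_left: "split_conv (\<lambda>l. c * f l) h xs = c * split_conv f h xs"
  by (simp add: split_conv_eq_sum sum_distrib_left mult.assoc)

lemma split_conv_sum_left:
  "split_conv (\<lambda>l. \<Sum>e\<in>A. f e l) h xs = (\<Sum>e\<in>A. split_conv (f e) h xs)"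
  by (simp add: split_conv_eq_sum sum_distrib_right sum.swap[of _ A])

lemma split_conv_add_right:
  "split_conv f (\<lambda>l. g l + h l) xs = split_conv f g xs + split_conv f h xs"
  by (simp add: split_conv_eq_sum distrib_left sum.distrib)

lemma split_conv_unit_left: "split_conv (\<lambda>l. of_bool (l = [])) g xs = g xs"
  by (cases xs) (simp_all add: split_conv_eq_sum)

lemma split_conv_unit_right: "split_conv f (\<lambda>l. of_bool (l = [])) xs = f xs"
  by (induction xs arbitrary: f) simp_all

lemma split_conv_assoc: "split_conv (split_conv f g) h xs = split_conv f (split_conv g h) xs"
proof (induction xs arbitrary: f)
  case (Cons x xs)
  then show ?case
    by (simp add: split_conv_add_left split_conv_mult_left distrib_left add.assoc)
qed simp

section \<open>First-return decompositions and commutation\<close>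

lemma split_conv_prime_count_Cons2:
  "split_conv prime_count f (a # b # ys) = f (b # ys) + (\<Sum>e\<in>{1..a}. split_conv prime_count f ((b + e) # ys))"
  by (simp add: split_conv_sum_left)

lemma sum_atMost_pred_split:
  "(\<Sum>e\<le>(a::nat). f e) = (f 0 :: nat) + (\<Sum>e\<in>{1..a}. f e)"
  by (metis One_nat_def atMost_atLeast0 sum.atLeast_Suc_atMost zero_le)

text \<open>A dominated sequence is cut at the first position where its partial sum meets that of
  the list: the piece before is indecomposable, the rest dominated. In the recursion,
  \<open>e = 0\<close> is a meeting right after the first entry.\<close>

lemma dom_count_eq_split_conv:
  "ys \<noteq> [] \<Longrightarrow> dom_count ys = split_conv prime_count dom_count ys"
proof (induction ys rule: dom_count.induct)
  case (3 a b ys)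
  then show ?case
    unfolding split_conv_prime_count_Cons2 dom_count.simps sum_atMost_pred_split by simp
qed simp_all

lemma dom_count_unfold:
  "dom_count = (\<lambda>l. of_bool (l = []) + split_conv prime_count dom_count l)"
proof
  show "dom_count l = of_bool (l = []) + split_conv prime_count dom_count l" for l
    using dom_count_eq_split_conv[of l] by (cases "l = []") simp_all
qed

text \<open>Both sides vanish on \<open>[]\<close>, where \<open>dom_count\<close> is 1; so
  \<open>init_count (Suc 0)\<close> is \<open>c\<close> without its unit term.\<close>

lemma init_count_1: "init_count (Suc 0) = split_conv prime_count dom_count"
proof
  show "init_count (Suc 0) l = split_conv prime_count dom_count l" for l
    using dom_count_eq_split_conv[of l] by (cases l) simp_all
qed

text \<open>For \<open>r = 0\<close> the new summand is the one that carries all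
  \<open>Suc a\<close> units over to \<open>b\<close>; for larger \<open>r\<close> the two heads
  merge first and the induction hypothesis applies.\<close>

lemma init_count_Suc_head:
  "init_count (Suc r) (Suc a # b # ys) = init_count (Suc r) (a # b # ys) + init_count (Suc r) (Suc (a + b) # ys)"
proof (induction r arbitrary: a b ys)
  case 0
  show ?case by (simp add: add.commute)
next
  case (Suc r)
  then show ?case by (cases ys; cases r) simp_all
qed

lemma init_count_add_head:
  "init_count (Suc r) ((a + b) # c # ys) = init_count (Suc r) (b # c # ys)
     + (\<Sum>e\<in>{1..a}. init_count (Suc r) ((b + e + c) # ys))"
  by (induction a) (simp_all add: init_count_Suc_head ac_simps)

text \<open>This is where the powers of \<open>q\<close> come from. Merging \<open>a\<close> into
  \<open>b\<close> adds \<open>a\<close> units to the head of \<open>b # ys\<close>; adding them one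
  by one yields the same sum as the first-entry expansion of
  \<open>split_conv prime_count\<close>.\<close>

lemma init_count_Suc:
  "init_count (Suc (Suc r)) ys = split_conv prime_count (init_count (Suc r)) ys"
proof (induction ys rule: dom_count.induct)
  case (3 a b ys)
  have "init_count (Suc r) ((a + b) # ys) =
      init_count (Suc r) (b # ys) + (\<Sum>e\<in>{1..a}. init_count (Suc (Suc r)) ((b + e) # ys))"
  proof (cases ys)
    case Nil
    then show ?thesis by (cases r) simp_all
  next
    case (Cons c zs)
    have "init_count (Suc (Suc r)) ((b + e) # ys) = init_count (Suc r) ((b + e + c) # zs)" for e
      using Cons by simp
    then show ?thesis unfolding Cons init_count_add_head by simp
  qed
  also have "\<dots> = split_conv prime_count (init_count (Suc r)) (a # b # ys)"
    unfolding split_conv_prime_count_Cons2 using 3 by simp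
  finally show ?case by simp
qed simp_all

lemma split_conv_cong:
  assumes "\<And>t. t \<le> length xs \<Longrightarrow> f (take t xs) * g (drop t xs) = f' (take t xs) * g' (drop t xs)"
  shows "split_conv f g xs = split_conv f' g' xs"
  unfolding split_conv_eq_sum using assms by (intro sum.cong) auto

text \<open>From \<open>c = 1 + q * c\<close> follow \<open>c * q = q + q * (c * q)\<close> and
  \<open>q * c = q + q * (q * c)\<close>, so the two products satisfy the same recursion.\<close>

lemma dom_count_prime_count_commute:
  "split_conv dom_count prime_count ys = split_conv prime_count dom_count ys"
proof (induction ys rule: length_induct)
  case (1 ys)
  have "split_conv dom_count prime_count ys = split_conv (\<lambda>l. of_bool (l = []) + split_conv prime_count dom_count l) prime_count ys"
    by (subst dom_count_unfold) simp
  also have "\<dots> = prime_count ys + split_conv prime_count (split_conv dom_count prime_count) ys"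
    by (simp add: split_conv_add_left split_conv_unit_left split_conv_assoc)
  also have "split_conv prime_count (split_conv dom_count prime_count) ys = split_conv prime_count (split_conv prime_count dom_count) ys"
  proof (rule split_conv_cong)
    \<comment> \<open>As \<open>prime_count [] = 0\<close>, only strictly shorter suffixes matter,
      and the induction hypothesis covers them.\<close>
    fix t assume t: "t \<le> length ys"
    show "prime_count (take t ys) * split_conv dom_count prime_count (drop t ys) = prime_count (take t ys) * split_conv prime_count dom_count (drop t ys)"
    proof (cases "t = 0 \<or> ys = []")
      case False
      then have "length (drop t ys) < length ys" by simp
      then show ?thesis using 1 by simp
    qed auto
  qed
  also have "prime_count ys + split_conv prime_count (split_conv prime_count dom_count) ys
      = split_conv prime_count (\<lambda>l. of_bool (l = []) + split_conv prime_count dom_count l) ys"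
    by (simp add: split_conv_add_right split_conv_unit_right)
  also have "\<dots> = split_conv prime_count dom_count ys"
    by (subst (2) dom_count_unfold) simp
  finally show ?case .
qed

lemma dom_count_init_count_commute:
  "split_conv dom_count (init_count r) ys = split_conv (init_count r) dom_count ys"
proof (cases r)
  case 0
  have "init_count 0 = (\<lambda>l. 0)" by (rule ext) simp
  then show ?thesis using 0 by (simp add: split_conv_eq_sum)
next
  case (Suc r')
  have *: "split_conv dom_count prime_count = split_conv prime_count dom_count" by (rule ext) (rule dom_count_prime_count_commute)
  have "split_conv dom_count (init_count (Suc r')) = split_conv (init_count (Suc r')) dom_count"
  proof (induction r')
    case 0
    show ?case unfolding init_count_1 by (rule ext) (simp add: split_conv_assoc[symmetric] *)
  next
    case (Suc r)
    have l: "init_count (Suc (Suc r)) = split_conv prime_count (init_count (Suc r))" by (rule ext) (rule init_count_Suc)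
    show ?case
    proof
      fix ys
      have "split_conv dom_count (init_count (Suc (Suc r))) ys = split_conv (split_conv prime_count dom_count) (init_count (Suc r)) ys"
        unfolding l by (simp add: split_conv_assoc[symmetric] *)
      also have "\<dots> = split_conv prime_count (split_conv (init_count (Suc r)) dom_count) ys"
        by (simp add: split_conv_assoc Suc)
      also have "\<dots> = split_conv (init_count (Suc (Suc r))) dom_count ys"
        unfolding l by (simp add: split_conv_assoc)
      finally show "split_conv dom_count (init_count (Suc (Suc r))) ys = split_conv (init_count (Suc (Suc r))) dom_count ys" .
    qed
  qed
  then show ?thesis using Suc by simp
qed

text \<open>For a sequence dominated by \<open>Suc a # ys\<close>, cut at the first position where
  the surplus is 0. Taking one unit off the sequence there gives a prefix dominated by that of
  \<open>a # ys\<close>; the prefix is nonempty, whence \<open>init_count (Suc 0)\<close>.\<close>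

lemma dom_count_Suc_head:
  "dom_count (Suc a # ys) = split_conv (init_count (Suc 0)) dom_count (a # ys)"
proof (induction "a # ys" arbitrary: a ys rule: dom_count.induct)
  case (3 a b ys)
  have IH: "split_conv (\<lambda>l. dom_count ((b + e) # l)) dom_count ys = dom_count (Suc (b + e) # ys)" if "e \<le> a" for e
    using 3[of e] that by simp
  have "split_conv (init_count (Suc 0)) dom_count (a # b # ys)
      = dom_count (b # ys) + (\<Sum>e\<le>a. dom_count (Suc (b + e) # ys))"
    by (simp add: split_conv_sum_left IH)
  also have "\<dots> = dom_count (Suc a # b # ys)"
    by (subst dom_count.simps(3), subst sum.atMost_Suc_shift) simp
  finally show ?case by simp
qed simp_all

text \<open>For \<open>r > 1\<close> merging the two heads reduces to \<open>r - 1\<close>; on the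
  right, prefixes of length below 2 contribute 0.\<close>

lemma init_count_Suc_head_conv:
  "init_count r (Suc a # ys) = split_conv (init_count r) dom_count (a # ys)"
proof (induction r arbitrary: a ys)
  case 0
  then show ?case by (simp add: split_conv_eq_sum)
next
  case (Suc r)
  show ?case
  proof (cases r)
    case 0
    then show ?thesis using dom_count_Suc_head[of a ys] by simp
  next
    case (Suc r')
    show ?thesis
    proof (cases ys)
      case Nil
      then show ?thesis using Suc by simp
    next
      case (Cons b zs)
      then show ?thesis using Suc.IH[of "a + b" zs] Suc by simp
    qed
  qed
qed

text \<open>The last entry of the list affects only the total, and the last entry of the counted
  sequence absorbs it.\<close>

lemma dom_count_last: "dom_count (xs @ [a]) = dom_count (xs @ [b])"
proof (induction xs rule: dom_count.induct)
  case (2 x) then show ?case by simp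
qed simp_all

lemma init_count_last: "init_count r (xs @ [a]) = init_count r (xs @ [b])"
proof (induction r arbitrary: xs)
  case (Suc r)
  show ?case
  proof (cases r)
    case 0
    then show ?thesis using dom_count_last[of xs a b] by (cases xs) simp_all
  next
    case r: (Suc r')
    show ?thesis
    proof (cases xs rule: dom_count.cases)
      case (2 x)
      then show ?thesis using r by (cases r') simp_all
    next
      case (3 x y ys)
      then show ?thesis using r Suc[of "(x + y) # ys"] by simp
    qed (simp add: r)
  qed
qed simp

text \<open>Passing a unit on lowers a single partial sum by 1. The sequences lost are those that
  meet the old bound there; they split into two dominated pieces, and by
  \<open>dom_count_last\<close> the end \<open>z\<close> may stand for \<open>Suc z\<close>.\<close>

lemma dom_count_transfer:
  "dom_count (xs @ Suc z # x # ys) = dom_count (xs @ z # Suc x # ys) + dom_count (xs @ [z]) * dom_count (x # ys)"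
proof (induction xs rule: dom_count.induct)
  case 1
  show ?case
    by (simp only: append.simps dom_count.simps(3)) (subst sum.atMost_Suc_shift, simp)
next
  case (2 a)
  have "(\<Sum>e\<le>a. dom_count (Suc (z + e) # x # ys))
      = (\<Sum>e\<le>a. dom_count ((z + e) # Suc x # ys) + dom_count (x # ys))"
    by (rule sum.cong[OF refl], simp only: append.simps dom_count.simps(3)) (subst sum.atMost_Suc_shift, simp)
  then show ?case by (simp add: sum.distrib)
next
  case (3 a b xs)
  then show ?case by (simp add: sum.distrib sum_distrib_right)
qed

lemma init_count_transfer:
  "init_count r (xs @ Suc z # x # ys) = init_count r (xs @ z # Suc x # ys) + init_count r (xs @ [z]) * dom_count (x # ys)"
proof (induction r arbitrary: xs z)
  case (Suc r)
  show ?case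
  proof (cases r)
    case 0
    then show ?thesis using dom_count_transfer[of xs z x ys] by (cases xs) simp_all
  next
    case r: (Suc r')
    show ?thesis
    proof (cases xs rule: dom_count.cases)
      \<comment> \<open>Here the two entries merge, so the unit stays in the head, and
        \<open>init_count (Suc r) [z] = 0\<close> since \<open>r > 0\<close>.\<close>
      case 1
      then show ?thesis using r by simp
    next
      case (2 a)
      then show ?thesis using r Suc[of "[]" "a + z"] by simp
    next
      case (3 a b as)
      then show ?thesis using r Suc[of "(a + b) # as"] by simp
    qed
  qed
qed simp

subsection \<open>Summation over rotations\<close>

text \<open>For \<open>ys\<close> the block sizes minus 1 and \<open>r \<ge> 1\<close>, this is the
  number of parking functions of the given type with run at least \<open>r\<close>.\<close>

definition rot_count :: "nat \<Rightarrow> nat list \<Rightarrow> nat" where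
  "rot_count r ys = (\<Sum>t<length ys. init_count r (rotate t ys))"

lemma rot_count_rotate1: "rot_count r (rotate1 ys) = rot_count r ys"
proof (cases "length ys")
  case (Suc m)
  have "rot_count r (rotate1 ys) = (\<Sum>t<Suc m. init_count r (rotate (Suc t) ys))"
    unfolding rot_count_def by (simp add: Suc rotate_def funpow_swap1)
  also have "\<dots> = (\<Sum>t<m. init_count r (rotate (Suc t) ys)) + init_count r ys"
    using rotate_id[of "Suc m" ys] by (simp add: Suc)
  also have "\<dots> = rot_count r ys"
    unfolding rot_count_def Suc by (subst sum.lessThan_Suc_shift) simp
  finally show ?thesis .
qed simp

lemma rot_count_rotate: "rot_count r (rotate s ys) = rot_count r ys"
  by (induction s) (simp_all add: rot_count_rotate1)

lemma rot_count_append: "rot_count r (xs @ ys) = rot_count r (ys @ xs)"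
  using rot_count_rotate[of r "length xs" "xs @ ys"] by (simp add: rotate_append)

lemma rot_count_move_unit: "rot_count r (Suc x # zs @ [z]) = rot_count r (x # zs @ [Suc z])"
proof -
  let ?old = "x # zs @ [Suc z]" and ?new = "Suc x # zs @ [z]"
  let ?k = "Suc (length zs)"
  \<comment> \<open>In every proper rotation the last and first entries of the list stand side by
    side, so \<open>init_count_transfer\<close> measures the change; it is the term of
    \<open>split_conv dom_count (init_count r) ?old\<close> for the cut after \<open>Suc t\<close>
    entries.\<close>
  have rot: "init_count r (rotate (Suc t) ?old)
      = init_count r (rotate (Suc t) ?new) + dom_count (take (Suc t) ?old) * init_count r (drop (Suc t) ?old)"
    if "t < ?k" for t
  proof -
    from that have t: "t \<le> length zs" by simp
    have "init_count r (drop t zs @ [Suc z]) = init_count r (drop t zs @ [z])"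
      by (rule init_count_last)
    then show ?thesis
      using t init_count_transfer[of r "drop t zs" z x "take t zs"]
      by (simp add: rotate_drop_take)
  qed
  \<comment> \<open>The trivial cuts: an empty prefix gives the unrotated term, a full prefix gives
    0.\<close>
  have "split_conv dom_count (init_count r) ?old
      = init_count r ?old + (\<Sum>t<?k. dom_count (take (Suc t) ?old) * init_count r (drop (Suc t) ?old))"
  proof -
    have "init_count r [] = 0" by (cases r rule: nat.exhaust; cases "r - 1") simp_all
    moreover have "split_conv dom_count (init_count r) ?old
        = (\<Sum>t<Suc (Suc ?k). dom_count (take t ?old) * init_count r (drop t ?old))"
      unfolding split_conv_eq_sum by (intro sum.cong) auto
    moreover have "\<dots> = init_count r ?old + (\<Sum>t<Suc ?k. dom_count (take (Suc t) ?old) * init_count r (drop (Suc t) ?old))"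
      by (subst sum.lessThan_Suc_shift) simp
    ultimately show ?thesis by (simp only: sum.lessThan_Suc) simp
  qed
  moreover have "rot_count r ?old = init_count r ?old + (\<Sum>t<?k. init_count r (rotate (Suc t) ?old))"
    unfolding rot_count_def
    by (simp add: sum.lessThan_Suc_shift del: sum.lessThan_Suc rotate_Suc)
  moreover have "rot_count r ?new = init_count r ?new + (\<Sum>t<?k. init_count r (rotate (Suc t) ?new))"
    unfolding rot_count_def
    by (simp add: sum.lessThan_Suc_shift del: sum.lessThan_Suc rotate_Suc)
  moreover have "(\<Sum>t<?k. init_count r (rotate (Suc t) ?old)) = (\<Sum>t<?k. init_count r (rotate (Suc t) ?new))
      + (\<Sum>t<?k. dom_count (take (Suc t) ?old) * init_count r (drop (Suc t) ?old))"
    unfolding sum.distrib[symmetric] by (intro sum.cong refl rot) simp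
  \<comment> \<open>In the unrotated list the added head unit produces the product in the opposite
    order, and commutation closes the balance.\<close>
  moreover have "init_count r ?new = split_conv dom_count (init_count r) ?old"
    using init_count_last[of r "Suc x # zs" z "Suc z"] init_count_Suc_head_conv[of r x "zs @ [Suc z]"]
    by (simp only: dom_count_init_count_commute append.simps)
  ultimately show ?thesis by simp
qed

text \<open>A rotation makes \<open>a\<close> the last and \<open>b\<close> the first entry;
  \<open>rot_count_move_unit\<close> then transports the units one by one.\<close>

lemma rot_count_move: "rot_count r (xs @ a # b # ys) = rot_count r (xs @ 0 # (a + b) # ys)"
proof (induction a arbitrary: b)
  case (Suc a)
  have "rot_count r (xs @ Suc a # b # ys) = rot_count r (b # (ys @ xs) @ [Suc a])"
    using rot_count_append[of r "xs @ [Suc a]" "b # ys"] by simp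
  also have "\<dots> = rot_count r (Suc b # (ys @ xs) @ [a])"
    by (rule rot_count_move_unit[symmetric])
  also have "\<dots> = rot_count r (xs @ a # Suc b # ys)"
    using rot_count_append[of r "xs @ [a]" "Suc b # ys"] by simp
  finally show ?case using Suc[of "Suc b"] by simp
qed simp

lemma rot_count_concentrate:
  "rot_count r (replicate i 0 @ a # ys) = rot_count r (replicate (i + length ys) 0 @ [a + sum_list ys])"
proof (induction ys arbitrary: i a)
  case (Cons b ys)
  have "rot_count r (replicate i 0 @ a # b # ys) = rot_count r (replicate (Suc i) 0 @ (a + b) # ys)"
    using rot_count_move[of r "replicate i 0" a b ys]
    by (simp add: replicate_app_Cons_same)
  then show ?case using Cons[of "Suc i" "a + b"] by (simp add: add.assoc)
qed simp

section \<open>Evaluation at lists with at most one nonzero entry\<close>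

lemma dom_count_replicate_0: "dom_count (m # replicate c 0) = (m + c) choose c"
proof (induction c arbitrary: m)
  case (Suc c)
  have "dom_count (m # replicate (Suc c) 0) = (\<Sum>e\<le>m. (e + c) choose c)"
    using Suc by simp
  also have "\<dots> = Suc (m + c) choose Suc c"
    using sum_choose_upper[of c "m + c"] by (induction m) simp_all
  finally show ?case by simp
qed simp

lemma init_count_head_replicate_0:
  "init_count (Suc r) (m # replicate b 0) = (if r \<le> b then (m + b - r) choose (b - r) else 0)"
proof (induction r arbitrary: b)
  case 0
  show ?case by (simp add: dom_count_replicate_0)
next
  case (Suc r)
  then show ?case by (cases b) simp_all
qed

text \<open>The \<open>r\<close> forced zeros cost nothing while they fall on leading zeros of the
  list; each of the remaining \<open>r - a\<close> merges a zero behind \<open>m\<close> into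
  it.\<close>

lemma init_count_replicate_0:
  "init_count (Suc r) (replicate a 0 @ m # replicate b 0)
     = (if r \<le> a then (m + b) choose b
        else if r \<le> a + b then (m + a + b - r) choose (a + b - r) else 0)"
proof (induction a arbitrary: r)
  case 0
  show ?case using init_count_head_replicate_0[of r m b] by auto
next
  case (Suc a)
  obtain c cs where c: "replicate a 0 @ m # replicate b 0 = c # cs"
    by (cases a) auto
  show ?case
  proof (cases r)
    case 0
    then show ?thesis using Suc.IH[of 0] c by simp
  next
    case (Suc r')
    then show ?thesis using Suc.IH[of r'] c by simp
  qed
qed

lemma rotate_replicate_0:
  "t \<le> i \<Longrightarrow> rotate t (replicate i (0::nat) @ [m]) = replicate (i - t) 0 @ m # replicate t 0"
  using rotate_append[of "replicate t 0" "replicate (i - t) 0 @ [m]"]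
  by (simp flip: append_assoc replicate_add)

text \<open>Summation along a diagonal of Pascal's triangle. \<open>j = 0\<close> is separate
  because the truncated \<open>j - 1\<close> would yield 1.\<close>

lemma sum_choose_diag:
  "(\<Sum>b<j. (m + b) choose b) = (if j = 0 then 0 else (m + j) choose (j - 1))"
proof (induction j)
  case (Suc j)
  then show ?case by (cases j) simp_all
qed simp

text \<open>Once \<open>ys\<close> is concentrated in its last entry, rotation by \<open>t\<close>
  leaves \<open>i - t\<close> zeros in front and \<open>t\<close> behind, where
  \<open>i = length ys - 1\<close>. For \<open>r \<le> i\<close> the \<open>Suc r\<close> rotations
  with \<open>t \<ge> i - r\<close> give equal values, the others a diagonal sum.\<close>

lemma rot_count_value:
  assumes "ys \<noteq> []"
  defines "k \<equiv> length ys" and "n \<equiv> length ys + sum_list ys"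
  shows "rot_count (Suc r) ys = (if Suc r \<le> k then Suc r * ((n - Suc r) choose (k - Suc r))
     + (if Suc r = k then 0 else (n - Suc r) choose (k - Suc r - 1)) else 0)"
proof -
  obtain a zs where ys: "ys = a # zs" using assms by (cases ys) auto
  define i where "i = length zs"
  define m where "m = sum_list ys"
  have k: "k = Suc i" and n: "n = Suc i + m" by (simp_all add: k_def n_def ys i_def m_def)
  have "rot_count (Suc r) ys = rot_count (Suc r) (replicate i 0 @ [m])"
    using rot_count_concentrate[of "Suc r" 0 a zs] by (simp add: ys i_def m_def)
  also have "\<dots> = (\<Sum>t<Suc i. init_count (Suc r) (replicate (i - t) 0 @ m # replicate t 0))"
    unfolding rot_count_def by (rule sum.cong) (simp_all add: rotate_replicate_0)
  also have "\<dots> = (\<Sum>t<Suc i. if r \<le> i - t then (m + t) choose t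
         else if r \<le> i then (m + i - r) choose (i - r) else 0)"
    by (rule sum.cong) (auto simp: init_count_replicate_0)
  also have "\<dots> = (if r \<le> i then Suc r * ((m + i - r) choose (i - r)) +
      (\<Sum>t<i-r. (m + t) choose t) else 0)"
  proof (cases "r \<le> i")
    case True
    have "(\<Sum>t<Suc i. if r \<le> i - t then (m + t) choose t
         else if r \<le> i then (m + i - r) choose (i - r) else 0)
       = (\<Sum>t\<in>{..i-r} \<union> {i-r<..i}. if r \<le> i - t then (m + t) choose t else (m + i - r) choose (i - r))"
      using True by (intro sum.cong) auto
    also have "\<dots> = (\<Sum>t\<in>{..i-r}. if r \<le> i - t then (m + t) choose t else (m + i - r) choose (i - r))
       + (\<Sum>t\<in>{i-r<..i}. if r \<le> i - t then (m + t) choose t else (m + i - r) choose (i - r))"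
      by (rule sum.union_disjoint) auto
    also have "(\<Sum>t\<in>{..i-r}. if r \<le> i - t then (m + t) choose t else (m + i - r) choose (i - r))
       = (\<Sum>t<Suc (i-r). (m + t) choose t)"
      using True by (intro sum.cong) auto
    also have "(\<Sum>t\<in>{i-r<..i}. if r \<le> i - t then (m + t) choose t else (m + i - r) choose (i - r))
       = (\<Sum>t\<in>{i-r<..i}. (m + i - r) choose (i - r))"
      by (intro sum.cong) auto
    \<comment> \<open>The term \<open>t = i - r\<close> of the first sum joins the \<open>r\<close>
      constant ones, hence \<open>Suc r\<close>.\<close>
    finally show ?thesis using True by simp
  next
    case False
    then show ?thesis by (intro trans[OF sum.neutral]) auto
  qed
  finally show ?thesis
    unfolding sum_choose_diag using k n by (auto simp: Suc_diff_le add.commute)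
qed

text \<open>Two applications of Pascal's rule, stated additively because subtraction is truncated.
  The first summand becomes the number of parking functions with run exactly
  \<open>r\<close>.\<close>

lemma rot_count_step:
  assumes "ys \<noteq> []" "r \<ge> 1" "r \<le> length ys"
  defines "n \<equiv> length ys + sum_list ys"
  shows "rot_count r ys = r * ((n - r - 1) choose (length ys - r)) + rot_count (Suc r) ys"
proof -
  obtain q where q: "r = Suc q" using assms by (cases r) auto
  define k where "k = length ys"
  have kn: "k \<le> n" "r \<le> k" using assms by (auto simp: k_def)
  note v = rot_count_value[OF assms(1), folded n_def k_def]
  show ?thesis
  proof (cases "r = k")
    case True
    then show ?thesis using v[of q] v[of r] q k_def by simp
  next
    case False
    define i where "i = k - Suc r"
    define m where "m = n - Suc r"
    have k: "k = Suc r + i" and n: "n = Suc r + m" using False kn by (auto simp: i_def m_def)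
    show ?thesis
      unfolding k_def[symmetric]
      using v[of q] v[of r] q k n by (cases i) (auto simp: algebra_simps)
  qed
qed

lemma rot_count_1:
  assumes "ys \<noteq> []"
  shows "rot_count (Suc 0) ys = (length ys + sum_list ys) choose (length ys - 1)"
proof -
  obtain a zs where "ys = a # zs" using assms by (cases ys) auto
  then show ?thesis
    using rot_count_value[OF assms, of 0] by (cases zs) simp_all
qed

subsection \<open>Words as rotations with a set of values\<close>

text \<open>\<open>p\<close> is the previous value and \<open>u\<close> the upper bound for the next one, that is, one more than the number of
  letters already placed.\<close>
fun parking_seq :: "nat \<Rightarrow> nat \<Rightarrow> nat list \<Rightarrow> nat list \<Rightarrow> bool" where
  "parking_seq p u [] [] \<longleftrightarrow> True"
| "parking_seq p u (b # bs) (s # ss) \<longleftrightarrow> p < s \<and> s \<le> u \<and> parking_seq s (u + b) bs ss"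
| "parking_seq _ _ _ _ \<longleftrightarrow> False"

lemma parking_seq_iff:
  "parking_seq p u bs ss \<longleftrightarrow> length ss = length bs \<and> sorted_wrt (<) (p # ss)
     \<and> (\<forall>m<length ss. ss ! m \<le> u + sum_list (take m bs))"
proof (induction p u bs ss rule: parking_seq.induct)
  case (2 p u b bs s ss)
  then show ?case
    by (auto simp: All_less_Suc2 add.assoc intro: less_trans)
qed auto

lemma parking_seq_Cons_eq:
  "{ss. parking_seq p u (b # bs) ss} = (\<Union>s\<in>{p<..u}. (#) s ` {ss. parking_seq s (u + b) bs ss})"
proof -
  have "parking_seq p u (b # bs) ss \<longleftrightarrow> (\<exists>s ss'. ss = s # ss' \<and> p < s \<and> s \<le> u \<and> parking_seq s (u + b) bs ss')" for ss
    by (cases ss) auto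
  then show ?thesis by auto
qed

lemma finite_parking_seq: "finite {ss. parking_seq p u bs ss}"
proof (induction bs arbitrary: p u)
  case Nil
  have "{ss. parking_seq p u [] ss} \<subseteq> {[]}" using parking_seq.elims(2) by fastforce
  then show ?case using finite_subset by blast
next
  case (Cons b bs)
  then show ?case unfolding parking_seq_Cons_eq by blast
qed

text \<open>The slack \<open>u - p - 1\<close> plays the role of the first list entry: choosing
  \<open>s\<close> leaves \<open>e = u - s\<close>, and the block size \<open>b\<close> raises the
  next slack to \<open>b - 1 + e\<close>.\<close>

lemma card_parking_seq:
  assumes "p < u" "\<forall>b\<in>set bs. b \<ge> 1"
  shows "card {ss. parking_seq p u bs ss} = dom_count ((u - p - 1) # map (\<lambda>b. b - 1) bs)"
  using assms
proof (induction bs arbitrary: p u)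
  case Nil
  have "{ss. parking_seq p u [] ss} = {[]}" using parking_seq.elims(2) by fastforce
  then show ?case by simp
next
  case (Cons b bs)
  have "card {ss. parking_seq p u (b # bs) ss} = (\<Sum>s\<in>{p<..u}. card ((#) s ` {ss. parking_seq s (u + b) bs ss}))"
    unfolding parking_seq_Cons_eq by (rule card_UN_disjoint) (auto simp: finite_parking_seq)
  also have "\<dots> = (\<Sum>s\<in>{p<..u}. dom_count ((u + b - s - 1) # map (\<lambda>b. b - 1) bs))"
    using Cons.prems by (intro sum.cong) (auto simp: card_image Cons.IH)
  also have "\<dots> = (\<Sum>e\<le>u - p - 1. dom_count ((b - 1 + e) # map (\<lambda>b. b - 1) bs))"
    using Cons.prems
    by (intro sum.reindex_bij_witness[of _ "\<lambda>e. u - e" "\<lambda>s. u - s"]) (auto intro!: arg_cong[of _ _ dom_count])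
  finally show ?case by simp
qed

text \<open>A forced value \<open>Suc p\<close> passes the whole slack on, which is the merging of
  heads in \<open>init_count\<close>.\<close>

lemma card_parking_seq_initial:
  assumes "p < u" "\<forall>b\<in>set bs. b \<ge> 1"
  shows "card {ss. parking_seq p u bs ss \<and> take r ss = [Suc p..<Suc (p + r)]}
           = init_count (Suc r) ((u - p - 1) # map (\<lambda>b. b - 1) bs)"
  using assms
proof (induction r arbitrary: p u bs)
  case 0
  then show ?case by (simp add: card_parking_seq)
next
  case (Suc r)
  show ?case
  proof (cases bs)
    case Nil
    have "{ss. parking_seq p u bs ss \<and> take (Suc r) ss = [Suc p..<Suc (p + Suc r)]} = {}"
      using Nil by (auto simp: upt_rec[of "Suc p"] simp del: upt_Suc elim!: parking_seq.elims(2))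
    then have "card {ss. parking_seq p u bs ss \<and> take (Suc r) ss = [Suc p..<Suc (p + Suc r)]} = 0"
      by (simp only: card.empty)
    then show ?thesis using Nil by (simp del: upt_Suc)
  next
    case (Cons b bs')
    have upt: "[Suc p..<Suc (Suc (p + r))] = Suc p # [Suc (Suc p)..<Suc (Suc (p + r))]"
      by (rule upt_conv_Cons) simp
    have "{ss. parking_seq p u bs ss \<and> take (Suc r) ss = [Suc p..<Suc (p + Suc r)]}
       = (#) (Suc p) ` {ss. parking_seq (Suc p) (u + b) bs' ss \<and> take r ss = [Suc (Suc p)..<Suc (Suc p + r)]}"
      (is "?A = _ ` ?B")
    proof -
      have "ss \<in> ?A \<longleftrightarrow> ss \<in> (#) (Suc p) ` ?B" for ss
        using Cons Suc.prems(1)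
        by (cases ss) (auto simp: upt simp del: upt_Suc)
      then show ?thesis by blast
    qed
    then have "card {ss. parking_seq p u bs ss \<and> take (Suc r) ss = [Suc p..<Suc (p + Suc r)]}
       = init_count (Suc r) ((u + b - Suc p - 1) # map (\<lambda>b. b - 1) bs')"
      using Suc.IH[of "Suc p" "u + b" bs'] Suc.prems Cons by (simp add: card_image del: upt_Suc)
    also have "u + b - Suc p - 1 = (u - p - 1) + (b - 1)"
      using Suc.prems Cons by auto
    finally show ?thesis using Cons by simp
  qed
qed

section \<open>Strictly increasing value lists and the run\<close>

definition incseqs :: "nat \<Rightarrow> nat \<Rightarrow> nat list set" where
  "incseqs n k = {s. sorted_wrt (<) s \<and> set s \<subseteq> {1..n} \<and> length s = k}"

lemma bij_betw_filter:
  "bij_betw f A B \<Longrightarrow> bij_betw f {x\<in>A. P (f x)} {y\<in>B. P y}"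
  by (auto simp: bij_betw_def inj_on_def)

lemma bij_betw_set_incseqs: "bij_betw set (incseqs n k) {S. S \<subseteq> {1..n} \<and> card S = k}"
proof (rule bij_betw_byWitness[where f' = sorted_list_of_set])
  show "\<forall>s\<in>incseqs n k. sorted_list_of_set (set s) = s"
    by (auto simp: incseqs_def strict_sorted_iff sorted_list_of_set.idem_if_sorted_distinct)
  show "\<forall>S\<in>{S. S \<subseteq> {1..n} \<and> card S = k}. set (sorted_list_of_set S) = S"
    by (auto dest: finite_subset)
  show "set ` incseqs n k \<subseteq> {S. S \<subseteq> {1..n} \<and> card S = k}"
    by (auto simp: incseqs_def strict_sorted_iff distinct_card)
  show "sorted_list_of_set ` {S. S \<subseteq> {1..n} \<and> card S = k} \<subseteq> incseqs n k"
    using finite_subset[of _ "{1..n}"] by (auto simp: incseqs_def subset_iff)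
qed

lemma finite_incseqs: "finite (incseqs n k)"
  using bij_betw_finite[OF bij_betw_set_incseqs[of n k]] by simp

lemma card_incseqs_initial:
  assumes "r \<le> n"
  shows "card {s\<in>incseqs n k. {1..r} \<subseteq> set s} = (if r \<le> k then (n - r) choose (k - r) else 0)"
proof -
  have "card {s\<in>incseqs n k. {1..r} \<subseteq> set s} = card {S. S \<subseteq> {1..n} \<and> card S = k \<and> {1..r} \<subseteq> S}"
  proof (rule bij_betw_same_card[of set])
    show "bij_betw set {s\<in>incseqs n k. {1..r} \<subseteq> set s} {S. S \<subseteq> {1..n} \<and> card S = k \<and> {1..r} \<subseteq> S}"
      using bij_betw_filter[OF bij_betw_set_incseqs[of n k], of "\<lambda>S. {1..r} \<subseteq> S"] by (simp add: conj_assoc)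
  qed
  also have "\<dots> = (if r \<le> k then (n - r) choose (k - r) else 0)"
  proof (cases "r \<le> k")
    case True
    have "card {S. S \<subseteq> {1..n} \<and> card S = k \<and> {1..r} \<subseteq> S} = card {T. T \<subseteq> {r<..n} \<and> card T = k - r}"
    proof (rule bij_betw_same_card[of "\<lambda>S. S - {1..r}"],
        rule bij_betw_byWitness[where f' = "\<lambda>T. T \<union> {1..r}"])
      show "(\<lambda>S. S - {1..r}) ` {S. S \<subseteq> {1..n} \<and> card S = k \<and> {1..r} \<subseteq> S} \<subseteq> {T. T \<subseteq> {r<..n} \<and> card T = k - r}"
        by (auto simp: card_Diff_subset)
      have "card (T \<union> {1..r}) = k" if "T \<subseteq> {r<..n}" "card T = k - r" for T
        using that True finite_subset[OF that(1)] by (subst card_Un_disjoint) auto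
      then show "(\<lambda>T. T \<union> {1..r}) ` {T. T \<subseteq> {r<..n} \<and> card T = k - r} \<subseteq> {S. S \<subseteq> {1..n} \<and> card S = k \<and> {1..r} \<subseteq> S}"
        using assms by fastforce
    qed auto
    also have "\<dots> = (n - r) choose (k - r)"
      by (subst n_subsets) auto
    finally show ?thesis using True by simp
  next
    case False
    have "card S \<ge> r" if "S \<subseteq> {1..n}" "{1..r} \<subseteq> S" for S
      using card_mono[OF finite_subset[OF that(1)] that(2)] by simp
    then show ?thesis using False by (auto simp: card_eq_0_iff)
  qed
  finally show ?thesis .
qed

lemma take_eq_upt_iff:
  assumes "sorted_wrt (<) s" "set s \<subseteq> {p<..}"
  shows "take r s = [Suc p..<Suc (p + r)] \<longleftrightarrow> {p<..p + r} \<subseteq> set s"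
proof
  assume "take r s = [Suc p..<Suc (p + r)]"
  then have "set [Suc p..<Suc (p + r)] \<subseteq> set s" by (metis set_take_subset)
  then show "{p<..p + r} \<subseteq> set s" by auto
next
  assume "{p<..p + r} \<subseteq> set s"
  then show "take r s = [Suc p..<Suc (p + r)]" using assms
  proof (induction r arbitrary: p s)
    case (Suc r)
    then obtain x xs where s: "s = x # xs" by (cases s) auto
    have "Suc p \<in> set s" using Suc.prems(1) by auto
    then have x: "x = Suc p" using Suc.prems s by fastforce
    have "take r xs = [Suc (Suc p)..<Suc (Suc p + r)]"
    proof (rule Suc.IH)
      show "{Suc p<..Suc p + r} \<subseteq> set xs"
      proof
        fix y assume "y \<in> {Suc p<..Suc p + r}"
        then have "y \<in> {p<..p + Suc r}" "y \<noteq> x" using x by auto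
        then show "y \<in> set xs" using Suc.prems(1) s by auto
      qed
      show "sorted_wrt (<) xs" "set xs \<subseteq> {Suc p<..}" using Suc.prems s x by auto
    qed
    then show ?case using s x by (simp add: upt_rec[of "Suc p"])
  qed simp
qed

text \<open>Containment is inherited by shorter initial intervals, so the maximum may be tested at
  \<open>r\<close>; the value 0 of \<open>run\<close> in the absence of 1 fits because
  \<open>r \<ge> 1\<close>.\<close>

lemma le_run_iff:
  assumes "a \<in> words n" "r \<ge> 1"
  shows "r \<le> run n a \<longleftrightarrow> {1..r} \<subseteq> a ` {1..n}"
proof -
  let ?R = "{i\<in>{1..n}. {1..i} \<subseteq> a ` {1..n}}"
  have im: "a ` {1..n} \<subseteq> {1..n}" using assms(1) by (auto simp: words_def)
  show ?thesis
  proof (cases "1 \<in> a ` {1..n}")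
    case True
    then have ne: "1 \<in> ?R" using im by auto
    have run: "run n a = Max ?R" using True by (simp add: run_def)
    show ?thesis
    proof
      assume "r \<le> run n a"
      moreover have "run n a \<in> ?R" unfolding run by (rule Max_in) (use ne in auto)
      ultimately show "{1..r} \<subseteq> a ` {1..n}" by force
    next
      assume r: "{1..r} \<subseteq> a ` {1..n}"
      then have "r \<in> {1..n}" using im assms(2) by fastforce
      then show "r \<le> run n a" unfolding run using r by (intro Max_ge) auto
    qed
  next
    case False
    then have "run n a = 0" "1 \<in> {1..r}" using assms by (auto simp: run_def)
    then show ?thesis using False assms(2) by auto
  qed
qed

lemma run_le:
  assumes "a \<in> words n"
  shows "run n a \<le> n"
proof (cases "run n a = 0")
  case False
  then have "{1..run n a} \<subseteq> a ` {1..n}" using le_run_iff[OF assms, of "run n a"] by simp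
  also have "\<dots> \<subseteq> {1..n}" using assms by (auto simp: words_def)
  finally show ?thesis using False by auto
qed simp

text \<open>Inverse to reading off the sorted values of a word with coimage \<open>Bs\<close>. The
  restriction to \<open>{1..n}\<close> gives the extensionality demanded by
  \<open>words\<close>.\<close>

definition word_of :: "nat \<Rightarrow> nat set list \<Rightarrow> nat list \<Rightarrow> nat \<Rightarrow> nat" where
  "word_of n Bs s = (\<lambda>x\<in>{1..n}. s ! (THE m. m < length Bs \<and> x \<in> Bs ! m))"

lemma ordered_partition_cover:
  assumes "ordered_partition n Bs" "x \<in> {1..n}"
  obtains m where "m < length Bs" "x \<in> Bs ! m"
  using assms unfolding ordered_partition_def by (metis UnionE in_set_conv_nth)

lemma ordered_partition_unique:
  assumes "ordered_partition n Bs" "i < length Bs" "j < length Bs" "x \<in> Bs ! i" "x \<in> Bs ! j"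
  shows "i = j"
  using assms unfolding ordered_partition_def by blast

lemma ordered_partition_subset:
  assumes "ordered_partition n Bs" "i < length Bs"
  shows "Bs ! i \<subseteq> {1..n}"
  using assms unfolding ordered_partition_def by (metis Union_upper nth_mem)

lemma word_of_nth:
  assumes "ordered_partition n Bs" "m < length Bs" "x \<in> Bs ! m"
  shows "word_of n Bs s x = s ! m"
proof -
  have "(THE m. m < length Bs \<and> x \<in> Bs ! m) = m"
    using assms ordered_partition_unique[OF assms(1)] by (intro the_equality) auto
  moreover have "x \<in> {1..n}" using ordered_partition_subset[OF assms(1,2)] assms(3) by blast
  ultimately show ?thesis by (simp add: word_of_def)
qed

lemma image_word_of:
  assumes P: "ordered_partition n Bs" and s: "length s = length Bs"
  shows "word_of n Bs s ` {1..n} = set s"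
proof
  show "word_of n Bs s ` {1..n} \<subseteq> set s"
    using ordered_partition_cover[OF P] word_of_nth[OF P] s by (metis image_subsetI nth_mem)
  show "set s \<subseteq> word_of n Bs s ` {1..n}"
  proof
    fix y assume "y \<in> set s"
    then obtain m where m: "m < length Bs" "y = s ! m" using s by (metis in_set_conv_nth)
    then obtain x where "x \<in> Bs ! m" using P unfolding ordered_partition_def by blast
    then show "y \<in> word_of n Bs s ` {1..n}"
      using m word_of_nth[OF P] ordered_partition_subset[OF P] by (metis image_eqI subsetD)
  qed
qed

lemma word_of_in_words:
  assumes P: "ordered_partition n Bs" and s: "s \<in> incseqs n (length Bs)"
  shows "word_of n Bs s \<in> words n"
proof -
  have "word_of n Bs s ` {1..n} \<subseteq> {1..n}"
    using image_word_of[OF P] s by (simp add: incseqs_def)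
  then show ?thesis unfolding words_def by (auto simp: PiE_iff word_of_def)
qed

lemma fiber_word_of:
  assumes P: "ordered_partition n Bs" and s: "s \<in> incseqs n (length Bs)" and m: "m < length Bs"
  shows "{x\<in>{1..n}. word_of n Bs s x = s ! m} = Bs ! m"
proof -
  have d: "distinct s" "length s = length Bs" using s by (auto simp: incseqs_def strict_sorted_iff)
  show ?thesis
  proof (intro equalityI subsetI)
    fix x assume x: "x \<in> {x\<in>{1..n}. word_of n Bs s x = s ! m}"
    then obtain i where i: "i < length Bs" "x \<in> Bs ! i"
      using ordered_partition_cover[OF P] by blast
    then have "s ! i = s ! m" using word_of_nth[OF P] x by simp
    then show "x \<in> Bs ! m" using d i m by (simp add: nth_eq_iff_index_eq)
  next
    fix x assume "x \<in> Bs ! m"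
    then show "x \<in> {x\<in>{1..n}. word_of n Bs s x = s ! m}"
      using word_of_nth[OF P m] ordered_partition_subset[OF P m] by auto
  qed
qed

lemma bij_betw_word_of:
  assumes P: "ordered_partition n Bs"
  shows "bij_betw (word_of n Bs) (incseqs n (length Bs)) {a\<in>words n. coim n a = Bs}"
proof (rule bij_betw_byWitness[where f' = "\<lambda>a. sorted_list_of_set (a ` {1..n})"])
  have sl: "sorted_list_of_set (word_of n Bs s ` {1..n}) = s" if "s \<in> incseqs n (length Bs)" for s
    using that image_word_of[OF P, of s]
    by (simp add: incseqs_def strict_sorted_iff sorted_list_of_set.idem_if_sorted_distinct)
  then show "\<forall>s\<in>incseqs n (length Bs). sorted_list_of_set (word_of n Bs s ` {1..n}) = s" by blast
  have "coim n (word_of n Bs s) = Bs" if s: "s \<in> incseqs n (length Bs)" for s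
  proof (rule nth_equalityI)
    show "length (coim n (word_of n Bs s)) = length Bs"
      using s by (simp only: coim_def sl[OF s]) (simp add: incseqs_def)
    show "coim n (word_of n Bs s) ! m = Bs ! m" if "m < length (coim n (word_of n Bs s))" for m
      using that s fiber_word_of[OF P s, of m]
      by (simp only: coim_def sl[OF s]) (simp add: incseqs_def)
  qed
  then show "word_of n Bs ` incseqs n (length Bs) \<subseteq> {a\<in>words n. coim n a = Bs}"
    using word_of_in_words[OF P] by blast
  show "(\<lambda>a. sorted_list_of_set (a ` {1..n})) ` {a\<in>words n. coim n a = Bs} \<subseteq> incseqs n (length Bs)"
    by (auto simp: incseqs_def coim_def words_def PiE_iff)
  show "\<forall>a\<in>{a\<in>words n. coim n a = Bs}. word_of n Bs (sorted_list_of_set (a ` {1..n})) = a"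
  proof
    fix a assume a: "a \<in> {a\<in>words n. coim n a = Bs}"
    let ?s = "sorted_list_of_set (a ` {1..n})"
    show "word_of n Bs ?s = a"
    proof
      fix x show "word_of n Bs ?s x = a x"
      proof (cases "x \<in> {1..n}")
        case True
        then obtain m where m: "m < length Bs" "x \<in> Bs ! m"
          using ordered_partition_cover[OF P] by blast
        have "Bs ! m = {j\<in>{1..n}. a j = ?s ! m}" using a m(1) by (auto simp: coim_def)
        then show ?thesis using word_of_nth[OF P m, of ?s] m(2) by auto
      next
        case False
        have "word_of n Bs ?s x = undefined" using False by (auto simp: word_of_def restrict_def)
        moreover have "a \<in> {1..n} \<rightarrow>\<^sub>E {1..n}" using a by (simp add: words_def)
        then have "a x = undefined" using False by (rule PiE_arb)
        ultimately show ?thesis by simp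
      qed
    qed
  qed
qed

lemma card_coim_eq:
  assumes "ordered_partition n Bs"
  shows "card {a\<in>words n. coim n a = Bs \<and> P a} = card {s\<in>incseqs n (length Bs). P (word_of n Bs s)}"
proof -
  note b = bij_betw_word_of[OF assms]
  have "bij_betw (word_of n Bs) {s\<in>incseqs n (length Bs). P (word_of n Bs s)}
      {a\<in>words n. coim n a = Bs \<and> P a}"
    using bij_betw_filter[OF b, of P] by (simp add: conj_assoc)
  then show ?thesis by (simp add: bij_betw_same_card)
qed

section \<open>The parking condition in terms of block sizes\<close>

lemma card_Union_nth:
  assumes P: "ordered_partition n Bs" and m: "m \<le> length Bs"
  shows "card (\<Union>i<m. Bs ! i) = sum_list (take m (map card Bs))"
proof -
  have "card (\<Union>i<m. Bs ! i) = (\<Sum>i<m. card (Bs ! i))"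
  proof (rule card_UN_disjoint)
    show "\<forall>i\<in>{..<m}. finite (Bs ! i)"
      using ordered_partition_subset[OF P] m by (metis finite_atLeastAtMost finite_subset lessThan_iff less_le_trans)
    show "\<forall>i\<in>{..<m}. \<forall>j\<in>{..<m}. i \<noteq> j \<longrightarrow> Bs ! i \<inter> Bs ! j = {}"
      using P m unfolding ordered_partition_def by auto
  qed simp
  also have "\<dots> = sum_list (take m (map card Bs))"
    using m by (auto simp: sum_list_sum_nth atLeast0LessThan intro!: sum.cong)
  finally show ?thesis .
qed

lemma sum_list_card_blocks:
  assumes P: "ordered_partition n Bs"
  shows "sum_list (map card Bs) = n"
proof -
  have "(\<Union>i<length Bs. Bs ! i) = \<Union>(set Bs)" by (auto simp: set_conv_nth)
  then show ?thesis
    using card_Union_nth[OF P, of "length Bs"] P by (simp add: ordered_partition_def)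
qed

lemma card_block_ge_1:
  assumes P: "ordered_partition n Bs" and "i < length Bs"
  shows "card (Bs ! i) \<ge> 1"
  using assms ordered_partition_subset[OF P, of i] finite_subset[of "Bs ! i"]
  by (auto simp: ordered_partition_def Suc_le_eq card_gt_0_iff)

text \<open>The number of letters below \<open>s ! m\<close> is the size of the first
  \<open>m\<close> blocks, and the count is constant between consecutive values, so the condition
  need be tested only at \<open>i = s ! m - 1\<close>.\<close>

lemma parking_word_of_iff:
  assumes P: "ordered_partition n Bs" and s: "s \<in> incseqs n (length Bs)"
  shows "parking_function n (word_of n Bs s) \<longleftrightarrow> parking_seq 0 1 (map card Bs) s"
proof -
  let ?a = "word_of n Bs s" and ?k = "length Bs"
  have l: "length s = ?k" and so: "sorted_wrt (<) s" and sub: "set s \<subseteq> {1..n}"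
    using s by (auto simp: incseqs_def)
  have less: "{j\<in>{1..n}. ?a j < s ! m} = (\<Union>i<m. Bs ! i)" if m: "m < ?k" for m
  proof (intro equalityI subsetI)
    fix x assume x: "x \<in> {j\<in>{1..n}. ?a j < s ! m}"
    then obtain i where i: "i < ?k" "x \<in> Bs ! i"
      using ordered_partition_cover[OF P] by blast
    then have "s ! i < s ! m" using word_of_nth[OF P i, of s] x by simp
    then have "i < m" using so i m l
      by (metis linorder_neqE_nat not_less_iff_gr_or_eq sorted_wrt_nth_less)
    then show "x \<in> (\<Union>i<m. Bs ! i)" using i by auto
  next
    fix x assume "x \<in> (\<Union>i<m. Bs ! i)"
    then obtain i where i: "i < m" "x \<in> Bs ! i" by auto
    then have "?a x = s ! i" "s ! i < s ! m" "x \<in> {1..n}"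
      using m l so word_of_nth[OF P _ i(2)] ordered_partition_subset[OF P, of i]
      by (auto simp: sorted_wrt_nth_less)
    then show "x \<in> {j\<in>{1..n}. ?a j < s ! m}" by simp
  qed
  have c: "card {j\<in>{1..n}. ?a j < s ! m} = sum_list (take m (map card Bs))" if "m < ?k" for m
    using less[OF that] card_Union_nth[OF P, of m] that by simp
  have "parking_function n ?a \<longleftrightarrow> (\<forall>m<?k. s ! m \<le> 1 + sum_list (take m (map card Bs)))"
  proof
    assume p: "parking_function n ?a"
    show "\<forall>m<?k. s ! m \<le> 1 + sum_list (take m (map card Bs))"
    proof (intro allI impI)
      fix m assume m: "m < ?k"
      then have sm: "s ! m \<in> {1..n}" using sub l by (metis nth_mem subsetD)
      show "s ! m \<le> 1 + sum_list (take m (map card Bs))"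
      \<comment> \<open>For the value 1 the index \<open>s ! m - 1\<close> leaves
        \<open>{1..n}\<close>, and the bound is trivial.\<close>
      proof (cases "s ! m = 1")
        case False
        then have "s ! m - 1 \<in> {1..n}" using sm by auto
        then have "s ! m - 1 \<le> card {j\<in>{1..n}. ?a j \<le> s ! m - 1}"
          using p unfolding parking_function_def by blast
        also have "{j\<in>{1..n}. ?a j \<le> s ! m - 1} = {j\<in>{1..n}. ?a j < s ! m}"
          using sm by auto
        finally show ?thesis using c[OF m] by simp
      qed simp
    qed
  next
    assume h: "\<forall>m<?k. s ! m \<le> 1 + sum_list (take m (map card Bs))"
    have "i \<le> card {j\<in>{1..n}. ?a j \<le> i}" if i: "i \<in> {1..n}" for i
    proof (cases "\<exists>m<?k. i < s ! m")
      case True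
      \<comment> \<open>The first value above \<open>i\<close>: all letters below it are at most
        \<open>i\<close>, and the hypothesis at \<open>m\<close> bounds \<open>i\<close> by their
        number.\<close>
      define m where "m = (LEAST m. m < ?k \<and> i < s ! m)"
      have m: "m < ?k" "i < s ! m" using LeastI_ex[OF True] by (auto simp: m_def)
      have mle: "s ! m' \<le> i" if "m' < m" for m'
        using not_less_Least[of m' "\<lambda>m. m < ?k \<and> i < s ! m"] that m by (auto simp: m_def)
      have "{j\<in>{1..n}. ?a j < s ! m} \<subseteq> {j\<in>{1..n}. ?a j \<le> i}"
      proof
        fix x assume "x \<in> {j\<in>{1..n}. ?a j < s ! m}"
        then have x: "x \<in> (\<Union>i<m. Bs ! i)" "x \<in> {1..n}" using less[OF m(1)] by auto
        then obtain m' where "m' < m" "x \<in> Bs ! m'" by blast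
        then have "?a x \<le> i" using mle[of m'] word_of_nth[OF P, of m' x s] m(1) by simp
        then show "x \<in> {j\<in>{1..n}. ?a j \<le> i}" using x(2) by blast
      qed
      then have "card {j\<in>{1..n}. ?a j < s ! m} \<le> card {j\<in>{1..n}. ?a j \<le> i}"
        by (intro card_mono) auto
      moreover have "i \<le> sum_list (take m (map card Bs))" using h m by fastforce
      ultimately show ?thesis using c[OF m(1)] by simp
    next
      case False
      then have "?a j \<le> i" if "j \<in> {1..n}" for j
        using that word_of_nth[OF P] ordered_partition_cover[OF P that] by (metis not_le)
      then have "{j\<in>{1..n}. ?a j \<le> i} = {1..n}" by blast
      then show ?thesis using i by simp
    qed
    then show "parking_function n ?a"
      unfolding parking_function_def using word_of_in_words[OF P s] by blast
  qed
  moreover have "sorted_wrt (<) (0 # s)" using so sub by fastforce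
  ultimately show ?thesis unfolding parking_seq_iff using l by simp
qed

text \<open>Block \<open>m\<close> is nonempty and not yet counted in the bound on
  \<open>s ! m\<close>, so that bound is at most \<open>n\<close>.\<close>

lemma parking_seq_imp_incseqs:
  assumes P: "ordered_partition n Bs" and parking_seq: "parking_seq 0 1 (map card Bs) s"
  shows "s \<in> incseqs n (length Bs)"
proof -
  have l: "length s = length Bs" and so: "sorted_wrt (<) (0 # s)"
    and b: "\<And>m. m < length s \<Longrightarrow> s ! m \<le> 1 + sum_list (take m (map card Bs))"
    using parking_seq unfolding parking_seq_iff by auto
  have "s ! m \<le> n" if m: "m < length s" for m
  proof -
    have "sum_list (take m (map card Bs)) + card (Bs ! m) = sum_list (take (Suc m) (map card Bs))"
      using m l by (simp add: take_Suc_conv_app_nth)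
    also have "\<dots> \<le> sum_list (map card Bs)"
      by (metis append_take_drop_id le_add1 sum_list_append)
    finally show ?thesis
      using b[OF m] card_block_ge_1[OF P, of m] m l sum_list_card_blocks[OF P] by simp
  qed
  then have "\<forall>x\<in>set s. x \<le> n" by (metis in_set_conv_nth)
  then show ?thesis using so l by (auto simp: incseqs_def Suc_le_eq)
qed

lemma initial_iff_take:
  assumes "s \<in> incseqs n k"
  shows "{1..r} \<subseteq> set s \<longleftrightarrow> take r s = [Suc 0..<Suc (0 + r)]"
proof -
  have "sorted_wrt (<) s" "set s \<subseteq> {0<..}" using assms by (auto simp: incseqs_def)
  moreover have "{1..r} = {0<..0 + r}" by auto
  ultimately show ?thesis using take_eq_upt_iff[of s 0 r] by simp
qed

lemma le_run_word_of_iff: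
  assumes P: "ordered_partition n Bs" and s: "s \<in> incseqs n (length Bs)" and r: "r \<ge> 1"
  shows "r \<le> run n (word_of n Bs s) \<longleftrightarrow> {1..r} \<subseteq> set s"
  using le_run_iff[OF word_of_in_words[OF P s] r] image_word_of[OF P, of s] s
  by (simp add: incseqs_def)

lemma card_parking_coim:
  assumes P: "ordered_partition n Bs" and ne: "Bs \<noteq> []" and r: "r \<ge> 1"
  shows "card {a\<in>words n. coim n a = Bs \<and> parking_function n a \<and> r \<le> run n a}
    = init_count r (map (\<lambda>B. card B - 1) Bs)"
proof -
  obtain q where q: "r = Suc q" using r by (cases r) auto
  have "card {a\<in>words n. coim n a = Bs \<and> parking_function n a \<and> r \<le> run n a}
    = card {s\<in>incseqs n (length Bs). parking_function n (word_of n Bs s) \<and> r \<le> run n (word_of n Bs s)}"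
    by (rule card_coim_eq[OF P])
  also have "{s\<in>incseqs n (length Bs). parking_function n (word_of n Bs s) \<and> r \<le> run n (word_of n Bs s)}
     = {s. parking_seq 0 1 (map card Bs) s \<and> take r s = [Suc 0..<Suc (0 + r)]}"
    using parking_word_of_iff[OF P] le_run_word_of_iff[OF P _ r] initial_iff_take parking_seq_imp_incseqs[OF P]
    by blast
  \<comment> \<open>The additional head is the initial slack \<open>1 - 0 - 1 = 0\<close>; merging
    it into the entry of the first block lowers \<open>Suc r\<close> to \<open>r\<close>.\<close>
  also have "card \<dots> = init_count (Suc r) ((1 - 0 - 1) # map (\<lambda>b. b - 1) (map card Bs))"
    by (rule card_parking_seq_initial) (use card_block_ge_1[OF P] in \<open>auto simp: in_set_conv_nth\<close>)
  also have "\<dots> = init_count r (map (\<lambda>B. card B - 1) Bs)"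
    using ne q by (cases Bs) (simp_all add: comp_def)
  finally show ?thesis .
qed

section \<open>Rotations of an ordered partition\<close>

lemma ordered_partition_distinct: "ordered_partition n Bs \<Longrightarrow> distinct Bs"
  unfolding ordered_partition_def distinct_conv_nth by (metis inf.idem)

lemma ordered_partition_rotate:
  assumes P: "ordered_partition n Bs"
  shows "ordered_partition n (rotate j Bs)"
proof -
  have d: "distinct (rotate j Bs)" using ordered_partition_distinct[OF P] by simp
  have "B \<inter> C = {}" if "B \<in> set Bs" "C \<in> set Bs" "B \<noteq> C" for B C
    using that P unfolding ordered_partition_def in_set_conv_nth by metis
  then have "\<forall>i<length (rotate j Bs). \<forall>i'<length (rotate j Bs). i \<noteq> i' \<longrightarrow> rotate j Bs ! i \<inter> rotate j Bs ! i' = {}"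
    using d by (metis nth_eq_iff_index_eq nth_mem set_rotate)
  moreover have "{} \<notin> set Bs" using P unfolding ordered_partition_def in_set_conv_nth by metis
  then have "\<forall>i<length (rotate j Bs). rotate j Bs ! i \<noteq> {}" by (metis nth_mem set_rotate)
  moreover have "\<Union>(set (rotate j Bs)) = {1..n}" using P by (simp add: ordered_partition_def)
  ultimately show ?thesis unfolding ordered_partition_def by blast
qed

lemma rotate_inj:
  assumes "distinct Bs" "i < length Bs" "j < length Bs" "rotate i Bs = rotate j Bs"
  shows "i = j"
proof -
  have "rotate t Bs ! 0 = Bs ! t" if "t < length Bs" for t
    using that nth_rotate[of 0 Bs t] by (cases Bs) simp_all
  then have "Bs ! i = Bs ! j" using assms by metis
  then show ?thesis using assms by (simp add: nth_eq_iff_index_eq)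
qed

lemma finite_words: "finite (words n)"
  by (simp add: words_def finite_PiE)

lemma card_of_type:
  assumes P: "ordered_partition n As"
  shows "card {a\<in>words n. of_type n a As \<and> Q a}
    = (\<Sum>j<length As. card {a\<in>words n. coim n a = rotate j As \<and> Q a})"
proof -
  have "{a\<in>words n. of_type n a As \<and> Q a}
      = (\<Union>j<length As. {a\<in>words n. coim n a = rotate j As \<and> Q a})"
    by (auto simp: of_type_def)
  also have "card \<dots> = (\<Sum>j<length As. card {a\<in>words n. coim n a = rotate j As \<and> Q a})"
    by (rule card_UN_disjoint)
      (use rotate_inj[OF ordered_partition_distinct[OF P]] in \<open>auto simp: finite_words\<close>)
  finally show ?thesis .
qed

lemma card_parking_run_ge:
  assumes P: "ordered_partition n As" and r: "r \<ge> 1"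
  shows "card {a\<in>words n. of_type n a As \<and> parking_function n a \<and> r \<le> run n a}
    = rot_count r (map (\<lambda>B. card B - 1) As)"
proof -
  have "card {a\<in>words n. coim n a = rotate j As \<and> parking_function n a \<and> r \<le> run n a}
      = init_count r (rotate j (map (\<lambda>B. card B - 1) As))" if "j < length As" for j
    unfolding rotate_map using that
    by (intro card_parking_coim[OF ordered_partition_rotate[OF P] _ r]) auto
  then show ?thesis
    unfolding card_of_type[OF P] rot_count_def by (intro sum.cong) auto
qed

section \<open>Rook words and value sets of prescribed run\<close>

lemma card_incseqs_run:
  assumes "1 \<le> r" "r \<le> n"
  shows "card {s\<in>incseqs n k. {1..r} \<subseteq> set s \<and> \<not> {1..Suc r} \<subseteq> set s}
    = (if r \<le> k \<and> k \<le> n then (n - r - 1) choose (k - r) else 0)"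
proof -
  let ?A = "{s\<in>incseqs n k. {1..r} \<subseteq> set s}" and ?B = "{s\<in>incseqs n k. {1..Suc r} \<subseteq> set s}"
  have "{s\<in>incseqs n k. {1..r} \<subseteq> set s \<and> \<not> {1..Suc r} \<subseteq> set s} = ?A - ?B" by auto
  moreover have "card (?A - ?B) = card ?A - card ?B"
    by (rule card_Diff_subset) (auto simp: finite_incseqs)
  moreover have "card ?B = (if Suc r \<le> k \<and> r < n then (n - Suc r) choose (k - Suc r) else 0)"
  proof (cases "r < n")
    case False
    then have "Suc r \<in> {1..Suc r} - {1..n}" by simp
    then have "?B = {}" unfolding incseqs_def by blast
    then have "card ?B = 0" by (simp only: card.empty)
    then show ?thesis using False by simp
  qed (use card_incseqs_initial[of "Suc r" n k] in simp)
  moreover have "card ?A = (if r \<le> k then (n - r) choose (k - r) else 0)"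
    by (rule card_incseqs_initial[OF assms(2)])
  ultimately have eq: "card {s\<in>incseqs n k. {1..r} \<subseteq> set s \<and> \<not> {1..Suc r} \<subseteq> set s}
    = (if r \<le> k then (n - r) choose (k - r) else 0)
      - (if Suc r \<le> k \<and> r < n then (n - Suc r) choose (k - Suc r) else 0)" by simp
  show ?thesis
  proof (cases "r < k \<and> r < n")
    case True
    then obtain i m where "k = r + Suc i" "n = r + Suc m" by (metis less_iff_Suc_add add_Suc_right)
    then show ?thesis unfolding eq by simp
  next
    case False
    then show ?thesis unfolding eq using assms by auto
  qed
qed

text \<open>Each \<open>q < r\<close> admits exactly one shift, \<open>p - q\<close> modulo
  \<open>k\<close>, written with \<open>k - q\<close> to avoid truncated subtraction; distinct
  \<open>q\<close> give distinct shifts.\<close>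

lemma card_shift_mod:
  assumes "p < k" "r \<le> k"
  shows "card {j. j < k \<and> (\<exists>q<r. (q + j) mod k = p)} = (r::nat)"
proof -
  have "{j. j < k \<and> (\<exists>q<r. (q + j) mod k = p)} = (\<lambda>q. (p + (k - q)) mod k) ` {..<r}"
  proof (intro equalityI subsetI)
    fix j assume "j \<in> {j. j < k \<and> (\<exists>q<r. (q + j) mod k = p)}"
    then obtain q where q: "j < k" "q < r" "(q + j) mod k = p" by auto
    have "(p + (k - q)) mod k = ((q + j) + (k - q)) mod k"
      unfolding q(3)[symmetric] by (rule mod_add_left_eq)
    also have "(q + j) + (k - q) = j + k" using q assms by simp
    finally have "j = (p + (k - q)) mod k" using q by simp
    then show "j \<in> (\<lambda>q. (p + (k - q)) mod k) ` {..<r}" using q by blast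
  next
    fix j assume "j \<in> (\<lambda>q. (p + (k - q)) mod k) ` {..<r}"
    then obtain q where q: "q < r" "j = (p + (k - q)) mod k" by auto
    have "(q + j) mod k = (q + (p + (k - q))) mod k" unfolding q(2) by (rule mod_add_right_eq)
    also have "q + (p + (k - q)) = p + k" using q assms by simp
    finally have "(q + j) mod k = p" using assms by simp
    then show "j \<in> {j. j < k \<and> (\<exists>q<r. (q + j) mod k = p)}" using q assms by auto
  qed
  moreover have "inj_on (\<lambda>q. (p + (k - q)) mod k) {..<r}"
  \<comment> \<open>The map \<open>q \<mapsto> p - q\<close> modulo \<open>k\<close> is its own
    inverse.\<close>
  proof (rule inj_on_inverseI[where g = "\<lambda>j. (p + (k - j)) mod k"])
    fix q assume "q \<in> {..<r}"
    then have "q < k" using assms by simp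
    then show "(p + (k - (p + (k - q)) mod k)) mod k = q"
      using assms by (cases "q \<le> p") (auto simp: mod_if)
  qed
  ultimately show ?thesis by (simp add: card_image)
qed

lemma run_eq_iff:
  "run n a = r \<longleftrightarrow> r \<le> run n a \<and> \<not> Suc r \<le> run n a"
  by auto

text \<open>With run \<open>r\<close> the list \<open>s\<close> starts with
  \<open>1, ..., r\<close>, so its entry at the position \<open>q\<close> of the block of 1 is at
  most \<open>r\<close> iff \<open>q < r\<close>: the rook condition concerns only the
  rotation.\<close>

lemma card_rook_coim:
  assumes P: "ordered_partition n Bs" and n: "n \<ge> 1" and q: "q < length Bs" "1 \<in> Bs ! q"
    and r: "1 \<le> r" "r \<le> n"
  shows "card {a\<in>words n. coim n a = Bs \<and> rook_word n a \<and> run n a = r}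
    = (if q < r then card {s\<in>incseqs n (length Bs). {1..r} \<subseteq> set s \<and> \<not> {1..Suc r} \<subseteq> set s} else 0)"
proof -
  have rk: "rook_word n (word_of n Bs s) \<longleftrightarrow> q < r" if s: "s \<in> incseqs n (length Bs)"
    and run: "run n (word_of n Bs s) = r" for s
  proof -
    have t: "take r s = [Suc 0..<Suc (0 + r)]"
      using le_run_word_of_iff[OF P s r(1)] run initial_iff_take[OF s] by simp
    have l: "length s = length Bs" and so: "sorted_wrt (<) s" using s by (auto simp: incseqs_def)
    have "r \<le> length s" using arg_cong[OF t, of length] by (simp del: upt_Suc)
    have nth: "s ! i = Suc i" if "i < r" for i
      using that arg_cong[OF t, of "\<lambda>l. l ! i"] by (simp del: upt_Suc)
    have "s ! q \<le> r \<longleftrightarrow> q < r"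
    proof
      assume "q < r" then show "s ! q \<le> r" using nth by simp
    next
      assume h: "s ! q \<le> r"
      show "q < r"
      proof (rule ccontr)
        assume "\<not> q < r"
        then have "s ! (r - 1) < s ! q"
          using so q l r by (intro sorted_wrt_nth_less[of "(<)"]) auto
        then show False using nth[of "r - 1"] r h by simp
      qed
    qed
    then show ?thesis
      using word_of_in_words[OF P s] word_of_nth[OF P q, of s] run by (simp add: rook_word_def)
  qed
  have "card {a\<in>words n. coim n a = Bs \<and> rook_word n a \<and> run n a = r}
    = card {s\<in>incseqs n (length Bs). rook_word n (word_of n Bs s) \<and> run n (word_of n Bs s) = r}"
    by (rule card_coim_eq[OF P])
  also have "{s\<in>incseqs n (length Bs). rook_word n (word_of n Bs s) \<and> run n (word_of n Bs s) = r}
     = {s\<in>incseqs n (length Bs). q < r \<and> run n (word_of n Bs s) = r}"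
    using rk by blast
  also have "\<dots> = {s\<in>incseqs n (length Bs). q < r \<and> {1..r} \<subseteq> set s \<and> \<not> {1..Suc r} \<subseteq> set s}"
    unfolding run_eq_iff[of n _ r] using le_run_word_of_iff[OF P] r by (metis le_SucI)
  finally show ?thesis by simp
qed

lemma length_plus_sum_block_excess:
  assumes P: "ordered_partition n As"
  shows "length As + sum_list (map (\<lambda>B. card B - 1) As) = n"
proof -
  have "length xs + sum_list (map (\<lambda>B. card B - 1) xs) = sum_list (map card xs)"
    if "\<forall>B\<in>set xs. card B \<ge> 1" for xs :: "nat set list"
    using that by (induction xs) auto
  then show ?thesis
    using card_block_ge_1[OF P] sum_list_card_blocks[OF P] by (metis in_set_conv_nth)
qed

section \<open>Counts by run\<close>

lemma card_parking_run:
  assumes n: "n \<ge> 1" and P: "ordered_partition n As" and r: "1 \<le> r" "r \<le> n"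
  shows "card {a\<in>words n. of_type n a As \<and> parking_function n a \<and> run n a = r}
    = (if r \<le> length As then r * ((n - r - 1) choose (length As - r)) else 0)"
proof -
  let ?ys = "map (\<lambda>B. card B - 1) As"
  let ?A = "\<lambda>r. {a\<in>words n. of_type n a As \<and> parking_function n a \<and> r \<le> run n a}"
  have ne: "?ys \<noteq> []" using n P by (auto simp: ordered_partition_def)
  have "?A r - ?A (Suc r) = {a\<in>words n. of_type n a As \<and> parking_function n a \<and> run n a = r}"
    by auto
  moreover have "card (?A r - ?A (Suc r)) = card (?A r) - card (?A (Suc r))"
    by (rule card_Diff_subset) (auto simp: finite_words)
  ultimately have "card {a\<in>words n. of_type n a As \<and> parking_function n a \<and> run n a = r}
      = card (?A r) - card (?A (Suc r))" by simp
  also have "\<dots> = rot_count r ?ys - rot_count (Suc r) ?ys"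
    using r by (simp add: card_parking_run_ge[OF P])
  \<comment> \<open>For \<open>r > length As\<close> both counts vanish, whereas the truncated
    \<open>length As - r\<close> would turn the binomial into 1; hence the case distinction.\<close>
  also have "\<dots> = (if r \<le> length As then r * ((n - r - 1) choose (length As - r)) else 0)"
  proof (cases "r \<le> length As")
    case True
    then show ?thesis
      using rot_count_step[OF ne r(1)] length_plus_sum_block_excess[OF P] by simp
  next
    case False
    obtain q where "r = Suc q" using r by (cases r) auto
    then show ?thesis using rot_count_value[OF ne] False by simp
  qed
  finally show ?thesis .
qed

lemma card_rook_run:
  assumes n: "n \<ge> 1" and P: "ordered_partition n As" and r: "1 \<le> r" "r \<le> n"
  shows "card {a\<in>words n. of_type n a As \<and> rook_word n a \<and> run n a = r}
    = (if r \<le> length As then r * ((n - r - 1) choose (length As - r)) else 0)"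
proof -
  let ?k = "length As"
  let ?C = "card {s\<in>incseqs n ?k. {1..r} \<subseteq> set s \<and> \<not> {1..Suc r} \<subseteq> set s}"
  have kn: "?k \<le> n" using length_plus_sum_block_excess[OF P] by simp
  obtain p where p: "p < ?k" "1 \<in> As ! p" using ordered_partition_cover[OF P, of 1] n by auto
  have "card {a\<in>words n. coim n a = rotate j As \<and> rook_word n a \<and> run n a = r}
     = (if \<exists>q<r. (q + j) mod ?k = p then ?C else 0)" if j: "j < ?k" for j
  proof -
    obtain q where q: "q < length (rotate j As)" "1 \<in> rotate j As ! q"
      using ordered_partition_cover[OF ordered_partition_rotate[OF P], of 1] n by auto
    have nth: "rotate j As ! i = As ! ((i + j) mod ?k)" if "i < ?k" for i
      using that by (simp add: nth_rotate add.commute)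
    \<comment> \<open>\<open>q\<close> is the only position that rotation by \<open>j\<close> fills
      with block \<open>p\<close> of \<open>As\<close>.\<close>
    have "(\<exists>q<r. (q + j) mod ?k = p) \<longleftrightarrow> q < r" if "r \<le> ?k"
    proof -
      have "(i + j) mod ?k = p \<longleftrightarrow> i = q" if i: "i < ?k" for i
      proof
        assume "(i + j) mod ?k = p"
        then have "1 \<in> rotate j As ! i" using nth[OF i] p by simp
        then show "i = q"
          using ordered_partition_unique[OF ordered_partition_rotate[OF P]] i q by simp
      next
        assume "i = q"
        then have "1 \<in> As ! ((i + j) mod ?k)" using q nth[OF i] by simp
        then show "(i + j) mod ?k = p"
          using ordered_partition_unique[OF P _ p(1) _ p(2)] p(1) by (metis gr_implies_not0 mod_less_divisor not_gr_zero)
      qed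
      then show ?thesis using that by (metis order_less_le_trans)
    qed
    \<comment> \<open>For \<open>r > ?k\<close> no list of \<open>?k\<close> values contains
      \<open>1, ..., r\<close>, so both branches agree.\<close>
    moreover have "?C = 0" if "\<not> r \<le> ?k" using card_incseqs_run[OF r, of ?k] that by simp
    ultimately show ?thesis
      using card_rook_coim[OF ordered_partition_rotate[OF P] n q r]
      by (cases "r \<le> ?k") (simp_all only: length_rotate if_cancel simp_thms)
  qed
  then have "card {a\<in>words n. of_type n a As \<and> rook_word n a \<and> run n a = r}
      = (\<Sum>j<?k. if \<exists>q<r. (q + j) mod ?k = p then ?C else 0)"
    unfolding card_of_type[OF P] by (intro sum.cong) auto
  also have "\<dots> = card {j. j < ?k \<and> (\<exists>q<r. (q + j) mod ?k = p)} * ?C"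
    by (simp add: sum.If_cases Int_def)
  also have "\<dots> = (if r \<le> ?k then r * ((n - r - 1) choose (?k - r)) else 0)"
    using card_shift_mod[OF p(1), of r] card_incseqs_run[OF r, of ?k] kn by simp
  finally show ?thesis .
qed

lemma card_split_run:
  assumes "\<And>a. a \<in> words n \<Longrightarrow> Q a \<Longrightarrow> 1 \<le> run n a"
  shows "card {a\<in>words n. T a \<and> Q a} = (\<Sum>r\<in>{1..n}. card {a\<in>words n. T a \<and> Q a \<and> run n a = r})"
proof -
  have "{a\<in>words n. T a \<and> Q a} = (\<Union>r\<in>{1..n}. {a\<in>words n. T a \<and> Q a \<and> run n a = r})"
    using assms run_le by fastforce
  also have "card \<dots> = (\<Sum>r\<in>{1..n}. card {a\<in>words n. T a \<and> Q a \<and> run n a = r})"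
    by (rule card_UN_disjoint) (auto simp: finite_words)
  finally show ?thesis .
qed

theorem theorem4p10:
  fixes n k r :: nat and As :: "nat set list"
  assumes "n \<ge> 1" and "ordered_partition n As" and "length As = k"
    and "1 \<le> r" and "r \<le> n"
  shows "card {a. parking_function n a \<and> of_type n a As} = n choose (k - 1)
       \<and> card {a. rook_word n a \<and> of_type n a As} = n choose (k - 1)
       \<and> card {a. parking_function n a \<and> of_type n a As \<and> run n a = r}
           = (if r \<le> k then r * ((n - r - 1) choose (k - r)) else 0)
       \<and> card {a. rook_word n a \<and> of_type n a As \<and> run n a = r}
           = (if r \<le> k then r * ((n - r - 1) choose (k - r)) else 0)"
proof -
  note P = assms(2) and n = assms(1)
  let ?ys = "map (\<lambda>B. card B - 1) As"
  have ne: "?ys \<noteq> []" using n P by (auto simp: ordered_partition_def)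
  have park_words: "a \<in> words n" if "parking_function n a" for a
    using that by (simp add: parking_function_def)
  have rook_words: "a \<in> words n" if "rook_word n a" for a
    using that by (simp add: rook_word_def)
  have park_run: "1 \<le> run n a" if a: "parking_function n a" for a
  proof -
    have "1 \<le> card {j\<in>{1..n}. a j \<le> 1}"
      using a n unfolding parking_function_def by (meson atLeastAtMost_iff le_refl)
    then obtain j where "j \<in> {1..n}" "a j \<le> 1" by (force simp: Suc_le_eq card_gt_0_iff)
    moreover from this have "1 \<le> a j" using park_words[OF a] by (auto simp: words_def PiE_iff)
    ultimately have "1 \<in> a ` {1..n}" by (metis imageI le_antisym)
    then show ?thesis using le_run_iff[OF park_words[OF a], of 1] by simp
  qed
  have rook_run: "1 \<le> run n a" if a: "rook_word n a" for a
  proof -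
    have "1 \<le> a 1" using rook_words[OF a] n by (auto simp: words_def PiE_iff)
    then show ?thesis using a by (simp add: rook_word_def)
  qed
  have park: "card {a\<in>words n. of_type n a As \<and> parking_function n a} = n choose (k - 1)"
  proof -
    \<comment> \<open>A run of at least 1 is automatic, so the total is \<open>rot_count\<close> at
      1.\<close>
    have "{a\<in>words n. of_type n a As \<and> parking_function n a}
        = {a\<in>words n. of_type n a As \<and> parking_function n a \<and> 1 \<le> run n a}"
      using park_run by blast
    then show ?thesis
      using card_parking_run_ge[OF P, of 1] rot_count_1[OF ne] length_plus_sum_block_excess[OF P] assms(3)
      by simp
  qed
  \<comment> \<open>For every \<open>r\<close> the two classes have equally many words of run
    \<open>r\<close>, so the totals agree.\<close>
  have "card {a\<in>words n. of_type n a As \<and> rook_word n a}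
      = (\<Sum>r\<in>{1..n}. card {a\<in>words n. of_type n a As \<and> rook_word n a \<and> run n a = r})"
    by (rule card_split_run) (use rook_run in blast)
  also have "\<dots> = (\<Sum>r\<in>{1..n}. card {a\<in>words n. of_type n a As \<and> parking_function n a \<and> run n a = r})"
    by (intro sum.cong) (auto simp: card_rook_run[OF n P] card_parking_run[OF n P])
  also have "\<dots> = card {a\<in>words n. of_type n a As \<and> parking_function n a}"
    by (rule card_split_run[symmetric]) (use park_run in blast)
  finally have rook: "card {a\<in>words n. of_type n a As \<and> rook_word n a} = n choose (k - 1)"
    using park by simp
  have sets:
    "{a. parking_function n a \<and> of_type n a As} = {a\<in>words n. of_type n a As \<and> parking_function n a}"
    "{a. rook_word n a \<and> of_type n a As} = {a\<in>words n. of_type n a As \<and> rook_word n a}"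
    "{a. parking_function n a \<and> of_type n a As \<and> run n a = r}
       = {a\<in>words n. of_type n a As \<and> parking_function n a \<and> run n a = r}"
    "{a. rook_word n a \<and> of_type n a As \<and> run n a = r}
       = {a\<in>words n. of_type n a As \<and> rook_word n a \<and> run n a = r}"
    using park_words rook_words by blast+
  show ?thesis
    unfolding sets
    using park rook card_parking_run[OF n P assms(4,5)] card_rook_run[OF n P assms(4,5)] assms(3)
    by simp
qed

end
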